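(* Let $\mathbb{F}$ be any field, let $n,m,d$ be positive integers, let $X\subseteq\mathbb{F}^n$ be any set, let $F$ be an integer, and let $P_1,\ldots,P_m,Q\in\mathbb{F}[x_1,\ldots,x_n]$ be polynomials of total degree at most $d$ such that $|P_i(X)|\le F$ for every $1\le i\le m$. Suppose that every $\mathbf{x}\in X$ with $P_1(\mathbf{x})=\cdots=P_m(\mathbf{x})=0$ also satisfies $Q(\mathbf{x})=0$. Then there exist polynomials $R_1,\ldots,R_m\in\mathbb{F}[x_1,\ldots,x_n]$, each of total degree at most $D$, such that $Q(\mathbf{x})=\sum_{i=1}^m R_i(\mathbf{x})P_i(\mathbf{x})$ for every $\mathbf{x}\in X$, where $D=md(F-1)$ if $m\ge 2$ and $D=mdF$ if $m=1$.
   Context: For a polynomial $P$ and a set $X\subseteq\mathbb{F}^n$, $P(X)=\{P(\mathbf{x}) : \mathbf{x}\in X\}$ denotes the image of $P$ on $X$. The conclusion says equivalently that $Q-\sum_i R_iP_i$ lies in the ideal of polynomials vanishing on $X$.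
   Formalization: The case m ≥ 2 with F = 1 is excluded, since the claim fails there: for P_1 = P_2 = 1, Q = x, d = n = 1 and X the whole field, D = 0 would force Q to be constant on X. *)

theory Defs
  imports "HOL-Analysis.Analysis" "HOL-Library.Poly_Mapping"
begin

text \<open>
  Polynomials over a field \<open>'a\<close> in finitely many variables indexed by \<open>'n\<close>, as finitely
  supported maps from exponent vectors to coefficients; the ring structure is the one of
  \<^theory>\<open>HOL-Library.Poly_Mapping\<close>. The points are the elements of \<open>'a ^ 'n\<close>.
\<close>

type_synonym ('a, 'n) mpoly = "('n \<Rightarrow>\<^sub>0 nat) \<Rightarrow>\<^sub>0 'a"

definition mpoly_eval :: "('a::field, 'n::finite) mpoly \<Rightarrow> 'a ^ 'n \<Rightarrow> 'a" where
  "mpoly_eval p x =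
     (\<Sum>e \<in> Poly_Mapping.keys p.
        Poly_Mapping.lookup p e * (\<Prod>i\<in>UNIV. (x $ i) ^ Poly_Mapping.lookup e i))"

text \<open>
  The bound is an integer that may be negative; the zero polynomial (of degree \<open>-\<infinity>\<close>)
  satisfies every bound, and it is the only polynomial satisfying a negative one.
\<close>

definition total_degree_le :: "('a::field, 'n::finite) mpoly \<Rightarrow> int \<Rightarrow> bool" where
  "total_degree_le p D \<longleftrightarrow>
     (\<forall>e \<in> Poly_Mapping.keys p. int (\<Sum>i\<in>UNIV. Poly_Mapping.lookup e i) \<le> D)"

text \<open>
  The degree bound \<open>m * d * (F - 1)\<close>, used for \<open>m \<ge> 2\<close>, fails at \<open>F = 1\<close>: for \<open>P\<^sub>1 = P\<^sub>2 = 1\<close>, which have a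
  single value each and no common zero, it would force \<open>Q = x\<close> to be constant.
\<close>

lemma no_certificate_F_eq_1:
  fixes P :: "nat \<Rightarrow> (real, 1) mpoly" and Q :: "(real, 1) mpoly"
  defines "P \<equiv> \<lambda>_. 1" and "Q \<equiv> Poly_Mapping.single (Poly_Mapping.single 1 1) 1"
  shows "\<And>i. total_degree_le (P i) 1" "total_degree_le Q 1"
    and "\<And>i. card (mpoly_eval (P i) ` UNIV) = 1"
    and "\<And>i x. mpoly_eval (P i) x \<noteq> 0"
    and "\<not> (\<exists>R. (\<forall>i\<in>{1..2}. total_degree_le (R i) (2 * 1 * (1 - 1))) \<and>
           (\<forall>x. mpoly_eval Q x = (\<Sum>i=1..2. mpoly_eval (R i) x * mpoly_eval (P i) x)))"
proof -
  have P: "mpoly_eval (P i) x = 1" for i x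
    by (simp add: P_def mpoly_eval_def)
  show "total_degree_le (P i) 1" for i
    by (simp add: P_def total_degree_le_def)
  show "total_degree_le Q 1"
    by (simp add: Q_def total_degree_le_def)
  show "card (mpoly_eval (P i) ` UNIV) = 1" "mpoly_eval (P i) x \<noteq> 0" for i x
    by (simp_all add: P image_constant_conv)
  have Q: "mpoly_eval Q x = x $ 1" for x
    by (simp add: Q_def mpoly_eval_def)
  have const: "mpoly_eval p x = mpoly_eval p y"
    if "total_degree_le p 0" for p :: "(real, 1) mpoly" and x y
    unfolding mpoly_eval_def
    by (rule sum.cong) (use that in \<open>auto simp: total_degree_le_def\<close>)
  show "\<not> (\<exists>R. (\<forall>i\<in>{1..2}. total_degree_le (R i) (2 * 1 * (1 - 1))) \<and>
          (\<forall>x. mpoly_eval Q x = (\<Sum>i=1..2. mpoly_eval (R i) x * mpoly_eval (P i) x)))"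
  proof
    assume "\<exists>R. (\<forall>i\<in>{1..2}. total_degree_le (R i) (2 * 1 * (1 - 1))) \<and>
          (\<forall>x. mpoly_eval Q x = (\<Sum>i=1..2. mpoly_eval (R i) x * mpoly_eval (P i) x))"
    then obtain R :: "nat \<Rightarrow> (real, 1) mpoly"
      where R: "\<forall>i\<in>{1..2}. total_degree_le (R i) 0"
        and eq: "\<forall>x. x $ 1 = (\<Sum>i=1..2. mpoly_eval (R i) x)"
      unfolding P Q mult_1_right diff_self mult_zero_right by blast
    have "(\<Sum>i=1..2. mpoly_eval (R i) 0) = (\<Sum>i=1..2. mpoly_eval (R i) 1)"
      by (intro sum.cong refl const) (use R in blast)
    then have "(0 :: real ^ 1) $ 1 = (1 :: real ^ 1) $ 1"
      using eq by metis
    then show False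
      by simp
  qed
qed

end

theory Submission
  imports Defs
begin

text \<open>
  If \<open>A\<close> is the set of nonzero values of \<open>P\<^sub>i\<close> on \<open>X\<close>, Lagrange interpolation gives \<open>U\<^sub>i\<close> of degree
  \<open>d (|A| - 1)\<close> such that \<open>P\<^sub>i U\<^sub>i\<close> is \<open>0\<close> or \<open>1\<close> on \<open>X\<close>, according to whether \<open>P\<^sub>i\<close> vanishes.
  Hence \<open>1 - (1 - P\<^sub>1 U\<^sub>1) \<cdots> (1 - P\<^sub>m U\<^sub>m)\<close> is the indicator on \<open>X\<close> of the complement of the common
  zero set, so multiplication by it does not change \<open>Q\<close> on \<open>X\<close>; the telescoping identity
  \<open>1 - \<Prod>\<^sub>i (1 - P\<^sub>i U\<^sub>i) = \<Sum>\<^sub>i P\<^sub>i U\<^sub>i \<Prod>\<^sub>j\<^sub><\<^sub>i (1 - P\<^sub>j U\<^sub>j)\<close> exhibits the product as a combination of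
  the \<open>P\<^sub>i\<close>. If every \<open>P\<^sub>i\<close> has a zero on \<open>X\<close> then \<open>|A| \<le> F - 1\<close> and the degrees fit; otherwise
  some \<open>P\<^sub>i\<close> is invertible on \<open>X\<close>, and \<open>Q U\<^sub>i P\<^sub>i\<close> already equals \<open>Q\<close> on \<open>X\<close>.
\<close>

section \<open>Evaluation at a point is a ring homomorphism\<close>

text \<open>Cancellation can make the support of \<open>p + q\<close> smaller than the union of the
  supports; summing over a common finite superset lets the three evaluations be compared
  termwise.\<close>

lemma mpoly_eval_superset:
  assumes "finite K" "Poly_Mapping.keys p \<subseteq> K"
  shows "mpoly_eval p x =
    (\<Sum>e\<in>K. Poly_Mapping.lookup p e * (\<Prod>i\<in>UNIV. (x $ i) ^ Poly_Mapping.lookup e i))"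
  unfolding mpoly_eval_def
  by (rule sum.mono_neutral_left) (use assms in \<open>auto simp: in_keys_iff\<close>)

lemma mpoly_eval_add [simp]: "mpoly_eval (p + q) x = mpoly_eval p x + mpoly_eval q x"
proof -
  let ?K = "Poly_Mapping.keys p \<union> Poly_Mapping.keys q"
  have K: "finite ?K" "Poly_Mapping.keys (p + q) \<subseteq> ?K"
    using Poly_Mapping.keys_add[of p q] by auto
  show ?thesis
    using mpoly_eval_superset[OF K] mpoly_eval_superset[of ?K p x] mpoly_eval_superset[of ?K q x]
    by (simp add: lookup_add distrib_right sum.distrib)
qed

lemma mpoly_eval_zero [simp]: "mpoly_eval 0 x = 0"
  by (simp add: mpoly_eval_def)

lemma mpoly_eval_uminus [simp]: "mpoly_eval (- p) x = - mpoly_eval p x"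
  using mpoly_eval_add[of p "- p" x] by (simp add: eq_neg_iff_add_eq_0 add.commute)

lemma mpoly_eval_diff [simp]: "mpoly_eval (p - q) x = mpoly_eval p x - mpoly_eval q x"
  using mpoly_eval_add[of p "- q" x] by simp

lemma mpoly_eval_single:
  "mpoly_eval (Poly_Mapping.single e c) x =
    c * (\<Prod>i\<in>UNIV. (x $ i) ^ Poly_Mapping.lookup e i)"
  by (simp add: mpoly_eval_def)

lemma mpoly_eval_one [simp]: "mpoly_eval 1 x = 1"
  by (simp add: mpoly_eval_def)

text \<open>Reduces multiplicativity of evaluation to monomials, first in the right factor and then
  in the left.\<close>

lemma poly_mapping_single_add_induct [case_names zero single_add]:
  assumes "P 0" "\<And>k v p. P p \<Longrightarrow> P (Poly_Mapping.single k v + p)"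
  shows "P (p :: 'a \<Rightarrow>\<^sub>0 'b::monoid_add)"
proof (induction p rule: Poly_Mapping.update_induct)
  case const
  then show ?case by (rule assms(1))
next
  case (update p k v)
  have "Poly_Mapping.update k v p = Poly_Mapping.single k v + p"
    using update(1)
    by (intro poly_mapping_eqI)
      (auto simp: Poly_Mapping.lookup_update lookup_add lookup_single in_keys_iff)
  then show ?case using update assms(2) by simp
qed

lemma mpoly_eval_mult [simp]: "mpoly_eval (p * q) x = mpoly_eval p x * mpoly_eval q x"
proof -
  have single: "mpoly_eval (Poly_Mapping.single e c * q) x =
      mpoly_eval (Poly_Mapping.single e c) x * mpoly_eval q x" for e c
  proof (induction q rule: poly_mapping_single_add_induct)
    case (single_add k v q)
    then show ?case
      by (simp add: distrib_left mult_single mpoly_eval_single lookup_add power_add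
          prod.distrib)
  qed simp
  show ?thesis
    by (induction p rule: poly_mapping_single_add_induct) (simp_all add: distrib_right single)
qed

lemma mpoly_eval_prod: "mpoly_eval (\<Prod>i\<in>I. p i) x = (\<Prod>i\<in>I. mpoly_eval (p i) x)"
  by (induction I rule: infinite_finite_induct) simp_all

section \<open>Arithmetic of total degree bounds\<close>

lemma total_degree_le_zero: "total_degree_le 0 D"
  by (simp add: total_degree_le_def)

lemma total_degree_le_mono: "total_degree_le p D \<Longrightarrow> D \<le> E \<Longrightarrow> total_degree_le p E"
  by (force simp: total_degree_le_def)

lemma total_degree_le_const: "D \<ge> 0 \<Longrightarrow> total_degree_le (Poly_Mapping.single 0 c) D"
  by (auto simp: total_degree_le_def)

lemma total_degree_le_one: "D \<ge> 0 \<Longrightarrow> total_degree_le 1 D"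
  by (simp add: total_degree_le_def)

lemma total_degree_le_add:
  "total_degree_le p D \<Longrightarrow> total_degree_le q D \<Longrightarrow> total_degree_le (p + q) D"
  unfolding total_degree_le_def using Poly_Mapping.keys_add[of p q] by blast

lemma total_degree_le_diff:
  "total_degree_le p D \<Longrightarrow> total_degree_le q D \<Longrightarrow> total_degree_le (p - q) D"
  using total_degree_le_add[of p D "- q"] by (simp add: total_degree_le_def in_keys_iff)

lemma total_degree_le_mult:
  assumes "total_degree_le p D" "total_degree_le q E"
  shows "total_degree_le (p * q) (D + E)"
  unfolding total_degree_le_def
proof
  fix e assume "e \<in> Poly_Mapping.keys (p * q)"
  then obtain a b where ab: "a \<in> Poly_Mapping.keys p" "b \<in> Poly_Mapping.keys q" "e = a + b"
    using keys_mult[of p q] by blast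
  then show "int (\<Sum>i\<in>UNIV. Poly_Mapping.lookup e i) \<le> D + E"
    using assms by (auto simp: total_degree_le_def lookup_add sum.distrib intro!: add_mono)
qed

lemma total_degree_le_prod:
  assumes "\<And>i. i \<in> I \<Longrightarrow> total_degree_le (p i) D" "finite I"
  shows "total_degree_le (\<Prod>i\<in>I. p i) (int (card I) * D)"
  using assms(2,1)
proof (induction I rule: finite_induct)
  case empty
  then show ?case by (simp add: total_degree_le_one)
next
  case (insert i I)
  then have "total_degree_le (p i * (\<Prod>i\<in>I. p i)) (D + int (card I) * D)"
    by (intro total_degree_le_mult) auto
  with insert show ?case by (simp add: algebra_simps)
qed

section \<open>Interpolated inverses and telescoping\<close>

text \<open>For empty \<open>A\<close> and positive \<open>d\<close> the degree bound is negative and forces \<open>u = 0\<close>.\<close>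

lemma mpoly_inverse_on_values:
  fixes p :: "('a::field, 'n::finite) mpoly"
  assumes "finite A" "0 \<notin> A" "total_degree_le p (int d)"
  shows "\<exists>u. total_degree_le u (int d * (int (card A) - 1)) \<and>
           (\<forall>x. mpoly_eval p x \<in> A \<longrightarrow> mpoly_eval p x * mpoly_eval u x = 1)"
  using assms(1,2)
proof (induction A rule: finite_induct)
  case empty
  show ?case by (intro exI[of _ 0]) (simp add: total_degree_le_zero)
next
  case (insert a A)
  then obtain u where u: "total_degree_le u (int d * (int (card A) - 1))"
      "\<And>x. mpoly_eval p x \<in> A \<Longrightarrow> mpoly_eval p x * mpoly_eval u x = 1"
    by auto
  \<comment> \<open>Newton-style correction: the added term vanishes wherever \<open>p * u\<close>
    is already 1, and where \<open>p\<close> takes the value \<open>a\<close> it supplies exactly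
    the missing \<open>1 - p * u\<close> after multiplication by \<open>p\<close>. The degree bound
    grows by \<open>d\<close> per new value.\<close>
  define w where "w = u + Poly_Mapping.single 0 (inverse a) * (1 - p * u)"
  have "total_degree_le (p * u) (int d * int (card A))"
    using total_degree_le_mult[OF assms(3) u(1)] by (simp add: algebra_simps)
  then have "total_degree_le (Poly_Mapping.single 0 (inverse a) * (1 - p * u))
      (0 + int d * int (card A))"
    by (intro total_degree_le_mult total_degree_le_diff total_degree_le_const total_degree_le_one)
      auto
  moreover have "total_degree_le u (int d * int (card A))"
    using u(1) by (rule total_degree_le_mono) (simp add: algebra_simps)
  ultimately have "total_degree_le w (int d * int (card A))"
    unfolding w_def by (intro total_degree_le_add) simp_all
  moreover have "mpoly_eval p x * mpoly_eval w x = 1" if "mpoly_eval p x \<in> insert a A" for x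
  proof -
    have eq: "mpoly_eval p x * mpoly_eval w x = mpoly_eval p x * mpoly_eval u x +
        mpoly_eval p x * inverse a * (1 - mpoly_eval p x * mpoly_eval u x)"
      by (simp add: w_def mpoly_eval_single algebra_simps)
    show ?thesis
    proof (cases "mpoly_eval p x = a")
      case True
      with insert.prems show ?thesis unfolding eq by simp
    next
      case False
      with that u(2)[of x] show ?thesis unfolding eq by simp
    qed
  qed
  ultimately show ?case
    using insert.hyps by (intro exI[of _ w]) simp
qed

text \<open>Each summand is the difference of two consecutive partial products of the factors
  \<open>1 - z j\<close>.\<close>

lemma telescoping_one_minus_prod:
  fixes z :: "nat \<Rightarrow> 'a::comm_ring_1"
  shows "(\<Sum>i=1..m. z i * (\<Prod>j=1..<i. 1 - z j)) = 1 - (\<Prod>j=1..m. 1 - z j)"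
proof (induction m)
  case (Suc m)
  then show ?case by (simp add: atLeastLessThanSuc_atLeastAtMost algebra_simps)
qed simp

theorem theorem2:
  fixes X :: "('a::field ^ 'n::finite) set"
    and m d :: nat and F :: int
    and P :: "nat \<Rightarrow> ('a, 'n) mpoly" and Q :: "('a, 'n) mpoly"
  assumes "m > 0" and "d > 0"
    and "m \<ge> 2 \<longrightarrow> F \<noteq> 1"
    and "\<forall>i\<in>{1..m}. total_degree_le (P i) (int d)"
    and "total_degree_le Q (int d)"
    and "\<forall>i\<in>{1..m}. finite (mpoly_eval (P i) ` X) \<and> int (card (mpoly_eval (P i) ` X)) \<le> F"
    and "\<forall>x\<in>X. (\<forall>i\<in>{1..m}. mpoly_eval (P i) x = 0) \<longrightarrow> mpoly_eval Q x = 0"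
  defines "D \<equiv> (if m \<ge> 2 then int m * int d * (F - 1) else int m * int d * F)"
  shows "\<exists>R :: nat \<Rightarrow> ('a, 'n) mpoly.
           (\<forall>i\<in>{1..m}. total_degree_le (R i) D) \<and>
           (\<forall>x\<in>X. mpoly_eval Q x = (\<Sum>i=1..m. mpoly_eval (R i) x * mpoly_eval (P i) x))"
proof (cases "X = {}")
  case True
  then show ?thesis by (intro exI[of _ "\<lambda>_. 0"]) (simp add: total_degree_le_zero)
next
  case False
  define S where "S i = mpoly_eval (P i) ` X" for i
  have S: "finite (S i)" "int (card (S i)) \<le> F" if "i \<in> {1..m}" for i
    using assms(6) that by (auto simp: S_def)
  have "card (S 1) > 0"
    using S(1)[of 1] False \<open>m > 0\<close> by (simp add: card_gt_0_iff S_def)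
  then have F: "F \<ge> 1"
    using S(2)[of 1] \<open>m > 0\<close> by simp
  have "\<exists>u. total_degree_le u (int d * (int (card (S i - {0})) - 1)) \<and>
      (\<forall>x. mpoly_eval (P i) x \<in> S i - {0} \<longrightarrow> mpoly_eval (P i) x * mpoly_eval u x = 1)"
    if "i \<in> {1..m}" for i
    using that S(1) assms(4) by (intro mpoly_inverse_on_values) auto
  then obtain U where
    degU: "\<And>i. i \<in> {1..m} \<Longrightarrow> total_degree_le (U i) (int d * (int (card (S i - {0})) - 1))" and
    U: "\<And>i x. i \<in> {1..m} \<Longrightarrow> x \<in> X \<Longrightarrow> mpoly_eval (P i) x \<noteq> 0 \<Longrightarrow>
          mpoly_eval (P i) x * mpoly_eval (U i) x = 1"
    unfolding S_def by (metis (no_types, lifting) DiffI imageI singletonD)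
  show ?thesis
  proof (cases "\<exists>k\<in>{1..m}. 0 \<notin> S k")
    case True
    then obtain k where k: "k \<in> {1..m}" "0 \<notin> S k" by blast
    \<comment> \<open>Since \<open>P k\<close> has no zero on \<open>X\<close>, \<open>U k\<close>
      inverts it there, so one term suffices. Nothing is removed from \<open>S k\<close>, hence the
      bound \<open>d + d * (card (S k) - 1)\<close>.\<close>
    define R where "R i = (if i = k then Q * U k else 0)" for i
    have "total_degree_le (Q * U k) (int d * int (card (S k)))"
      using total_degree_le_mult[OF assms(5) degU[OF k(1)]] k(2) by (simp add: algebra_simps)
    moreover have "int d * int (card (S k)) \<le> D"
    proof -
      have "int (card (S k)) \<le> (if m \<ge> 2 then int m * (F - 1) else int m * F)"
      proof (cases "m \<ge> 2")
        case True
        then have "2 * (F - 1) \<le> int m * (F - 1)"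
          using F by (intro mult_right_mono) auto
        \<comment> \<open>This inequality amounts to \<open>F \<ge> 2\<close>, which is where the
          exclusion of \<open>F = 1\<close> for \<open>m \<ge> 2\<close> enters.\<close>
        moreover have "F \<le> 2 * (F - 1)"
          using F True assms(3) by auto
        ultimately show ?thesis using S(2)[OF k(1)] True by simp
      next
        case False
        then have "m = 1" using \<open>m > 0\<close> by simp
        then show ?thesis using S(2)[OF k(1)] by simp
      qed
      from mult_left_mono[OF this, of "int d"] show ?thesis
        by (auto simp: D_def algebra_simps split: if_splits)
    qed
    ultimately have "total_degree_le (R i) D" for i
      by (auto simp: R_def total_degree_le_zero intro: total_degree_le_mono)
    moreover have "mpoly_eval Q x = (\<Sum>i=1..m. mpoly_eval (R i) x * mpoly_eval (P i) x)"
      if "x \<in> X" for x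
    proof -
      have "mpoly_eval (P k) x \<noteq> 0"
        using k(2) that by (force simp: S_def)
      then have "mpoly_eval (Q * U k) x * mpoly_eval (P k) x = mpoly_eval Q x"
        using U[OF k(1) that] by (simp add: ac_simps)
      moreover have "(\<Sum>i=1..m. mpoly_eval (R i) x * mpoly_eval (P i) x) =
          (\<Sum>i=1..m. if i = k then mpoly_eval (Q * U k) x * mpoly_eval (P k) x else 0)"
        by (rule sum.cong) (auto simp: R_def)
      ultimately show ?thesis using k(1) by simp
    qed
    ultimately show ?thesis by blast
  next
    case False
    \<comment> \<open>Every \<open>S i\<close> now contains 0, so deleting it saves one
      value.\<close>
    then have card: "int (card (S i - {0})) \<le> F - 1" if "i \<in> {1..m}" for i
      using S[OF that] F that by (subst card_Diff_singleton) auto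
    have degU': "total_degree_le (U i) (int d * (F - 2))" if "i \<in> {1..m}" for i
      by (rule total_degree_le_mono[OF degU[OF that]]) (use card[OF that] in \<open>simp add: mult_left_mono\<close>)
    define V where "V i = 1 - P i * U i" for i
    have degV: "total_degree_le (V i) (int d * (F - 1))" if "i \<in> {1..m}" for i
    proof -
      have "int d + int d * (F - 2) = int d * (F - 1)"
        by (simp add: algebra_simps)
      then have "total_degree_le (P i * U i) (int d * (F - 1))"
        using total_degree_le_mult[OF assms(4)[rule_format, OF that] degU'[OF that]] by simp
      then show ?thesis
        \<comment> \<open>The constant 1 fits the bound because \<open>F \<ge> 1\<close>.\<close>
        unfolding V_def using F by (intro total_degree_le_diff total_degree_le_one) simp_all
    qed
    define R where "R i = Q * U i * (\<Prod>j=1..<i. V j)" for i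
    have "total_degree_le (R i) D" if i: "i \<in> {1..m}" for i
    proof -
      have "total_degree_le (\<Prod>j=1..<i. V j) (int (card {1..<i}) * (int d * (F - 1)))"
        by (rule total_degree_le_prod) (use i degV in auto)
      then have "total_degree_le (R i)
          (int d + int d * (F - 2) + int (card {1..<i}) * (int d * (F - 1)))"
        unfolding R_def by (intro total_degree_le_mult assms(5) degU'[OF i])
      \<comment> \<open>\<open>Q * U i\<close> contributes \<open>d * (F - 1)\<close>, as does each
        of the \<open>i - 1\<close> factors \<open>V j\<close>; the worst case is
        \<open>i = m\<close>.\<close>
      moreover have "int d + int d * (F - 2) + int (card {1..<i}) * (int d * (F - 1)) =
          int i * (int d * (F - 1))"
        using i by (simp add: of_nat_diff algebra_simps)
      moreover have "int i * (int d * (F - 1)) \<le> int m * (int d * (F - 1))"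
        using i F by (intro mult_right_mono) auto
      moreover have "int m * (int d * (F - 1)) \<le> D"
        by (simp add: D_def algebra_simps)
      ultimately show ?thesis by (metis total_degree_le_mono order_trans)
    qed
    moreover have "mpoly_eval Q x = (\<Sum>i=1..m. mpoly_eval (R i) x * mpoly_eval (P i) x)"
      if x: "x \<in> X" for x
    proof -
      define z where "z i = mpoly_eval (P i) x * mpoly_eval (U i) x" for i
      have "(\<Sum>i=1..m. mpoly_eval (R i) x * mpoly_eval (P i) x) =
          mpoly_eval Q x * (\<Sum>i=1..m. z i * (\<Prod>j=1..<i. 1 - z j))"
        by (simp add: sum_distrib_left R_def V_def z_def mpoly_eval_prod ac_simps)
      also have "\<dots> = mpoly_eval Q x * (1 - (\<Prod>j=1..m. 1 - z j))"
        by (simp only: telescoping_one_minus_prod)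
      also have "\<dots> = mpoly_eval Q x"
      proof (cases "\<forall>i\<in>{1..m}. mpoly_eval (P i) x = 0")
        case True
        then show ?thesis using assms(7) x by simp
      next
        case False
        \<comment> \<open>Where some \<open>P i\<close> is nonzero, \<open>z i = 1\<close>, and this
          one factor kills the whole product.\<close>
        then obtain i where "i \<in> {1..m}" "1 - z i = 0"
          using U x by (auto simp: z_def)
        then have "(\<Prod>j=1..m. 1 - z j) = 0"
          by (intro prod_zero) auto
        then show ?thesis by simp
      qed
      finally show ?thesis by simp
    qed
    ultimately show ?thesis by blast
  qed
qed

end
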